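(* Let Assumption 2 (stated in the context) hold. Let $(x_*,u_* )$ be a global optimum of the steady-state problem (P): $\min_{x,u}\Phi(x)$ s.t. $x=w(u)$, $h(x)\ge0$, $b(u)\ge0$. Assume that $h(x_* )=0$ and that MFCQ holds for (P) at $(x_*,u_* )$. For $p,\eta>0$ consider the problem $$(\mathrm{P}_{p,\eta}):\qquad \min_{x,u}\ \Phi(x)+p\,(\eta-h(x))^2\quad\text{s.t.}\quad x=w(u),\ b(u)\ge0,\ h(x)\ge0 .$$ Then, for any $c>0$, there exist $p,\eta>0$ such that any optimizer (global optimum) $(x_*',u_*')$ of $(\mathrm{P}_{p,\eta})$ satisfies $h(x_*')>0$ and $|\Phi(x_*')-\Phi(x_* )|<c$.
   Context: Conventions: for differentiable $g:\mathbb{R}^n\to\mathbb{R}^k$, $\frac{\partial g}{\partial x}\in\mathbb{R}^{k\times n}$ (so partial derivatives of scalar functions are row vectors); for scalar $g$, $\nabla g=(\frac{\partial g}{\partial x})^\top$. Plant: $\dot\xi=f(\xi,\upsilon)$ with $f:\mathbb{R}^n\times\mathbb{R}^m\to\mathbb{R}^n$. Assumption 1 (used to define $w$): for every constant input $\upsilon\equiv u$ the system has a unique globally exponentially stable equilibrium; it is denoted $w(u)$, giving a map $w:\mathbb{R}^m\to\mathbb{R}^n$ with $f(w(u),u)=0$. Data: $\Phi,h:\mathbb{R}^n\to\mathbb{R}$, $b:\mathbb{R}^m\to\mathbb{R}$. Fix $\beta>0$ and set $h_0(x,u)=h(x)$, $h_i(x,u)=\frac{\partial h_{i-1}}{\partial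 x}(x,u)f(x,u)+\beta h_{i-1}(x,u)$ for $i\ge1$. Let $\mathcal{S}=\{(x,u): h(x)\ge0,\ b(u)\ge0\}$ and $\mathcal{S}_i=\{(x,u): b(u)\ge0,\ h_i(x,u)\ge0\}$ for $i\ge0$. Assumption 2: (1) there is an integer $r\ge1$ such that $f$ is $(r+1)$-times and $h$ is $(r+2)$-times continuously differentiable; $\mathcal{S}_r\ne\emptyset$; $\frac{\partial h_r}{\partial u}(x,u)\ne0$ for all $(x,u)\in\mathcal{S}_r$ with $h_r(x,u)=0$; and $\frac{\partial h_i}{\partial u}(x,u)=0$ for all $(x,u)\in\mathcal{S}_r$ and all $i<r$. (2) $b$ is twice continuously differentiable, and $b(u)=0$ implies $\nabla b(u)\neq0$ for all $(x,u)\in\mathcal{S}$. (3) $\Phi$ and $w$ are twice continuously differentiable. MFCQ for (P) at $(x,u)$: there exist $\psi_x\in\mathbb{R}^n,\psi_u\in\mathbb{R}^m$ with $\psi_x=\frac{\partial w}{\partial u}(u)\psi_u$, $\nabla h(x)^\top\psi_x>0$ if $h(x)=0$, and $\nabla b(u)^\top\psi_u>0$ if $b(u)=0$. *)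

theory Defs
  imports "HOL-Analysis.Analysis"
begin

section \<open>Derivatives\<close>

definition gradient :: "(real^'n \<Rightarrow> real) \<Rightarrow> real^'n \<Rightarrow> real^'n" where
  "gradient g x = (\<chi> i. frechet_derivative g (at x) (axis i 1))"

lemma gderiv_gradient:
  fixes g :: "real^'n \<Rightarrow> real"
  assumes "g differentiable (at x)"
  shows "GDERIV g x :> gradient g x"
proof -
  have lin: "linear (frechet_derivative g (at x))"
    using assms by (rule linear_frechet_derivative)
  have "frechet_derivative g (at x) = (\<lambda>v. v \<bullet> gradient g x)"
  proof
    fix v :: "real^'n"
    have "frechet_derivative g (at x) v = frechet_derivative g (at x) (\<Sum>i\<in>UNIV. (v $ i) *\<^sub>R axis i 1)"
      by (simp add: basis_expansion flip: scalar_mult_eq_scaleR)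
    also have "\<dots> = (\<Sum>i\<in>UNIV. v $ i * frechet_derivative g (at x) (axis i 1))"
      by (simp add: linear_sum[OF lin] linear_scale[OF lin])
    also have "\<dots> = v \<bullet> gradient g x"
      by (simp add: inner_vec_def gradient_def)
    finally show "frechet_derivative g (at x) v = v \<bullet> gradient g x" .
  qed
  with assms show ?thesis
    unfolding gderiv_def frechet_derivative_works by simp
qed

definition grad_x :: "((real^'n) \<times> (real^'m) \<Rightarrow> real) \<Rightarrow> real^'n \<Rightarrow> real^'m \<Rightarrow> real^'n" where
  "grad_x g x u = gradient (\<lambda>x'. g (x', u)) x"

definition grad_u :: "((real^'n) \<times> (real^'m) \<Rightarrow> real) \<Rightarrow> real^'n \<Rightarrow> real^'m \<Rightarrow> real^'m" where
  "grad_u g x u = gradient (\<lambda>u'. g (x, u')) u"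

(* Being k times continuously differentiable on the whole space. In finite dimension, g is C^(k+1)
   iff it is differentiable and all its directional derivatives are C^k. *)
primrec Ck :: "nat \<Rightarrow> ('a::euclidean_space \<Rightarrow> 'b::euclidean_space) \<Rightarrow> bool" where
  "Ck 0 g \<longleftrightarrow> continuous_on UNIV g"
| "Ck (Suc k) g \<longleftrightarrow> (\<forall>x. g differentiable (at x)) \<and> (\<forall>v. Ck k (\<lambda>x. frechet_derivative g (at x) v))"

section \<open>The plant and its steady-state map\<close>

definition plant_solution ::
  "((real^'n) \<times> (real^'m) \<Rightarrow> real^'n) \<Rightarrow> real^'m \<Rightarrow> real^'n \<Rightarrow> (real \<Rightarrow> real^'n) \<Rightarrow> bool" where
  "plant_solution f u \<xi>0 \<xi> \<longleftrightarrow>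
     \<xi> 0 = \<xi>0 \<and> (\<forall>t\<ge>0. (\<xi> has_vector_derivative f (\<xi> t, u)) (at t within {0..}))"

(* Forward completeness is stated explicitly, so that the exponential bound on all solutions
   defined on [0, oo) cannot hold vacuously. The constants K and l may depend on u and on the
   equilibrium, but not on the initial state. *)
definition glob_exp_stable_equilibrium ::
  "((real^'n) \<times> (real^'m) \<Rightarrow> real^'n) \<Rightarrow> real^'m \<Rightarrow> real^'n \<Rightarrow> bool" where
  "glob_exp_stable_equilibrium f u xe \<longleftrightarrow>
     f (xe, u) = 0 \<and>
     (\<forall>\<xi>0. \<exists>\<xi>. plant_solution f u \<xi>0 \<xi>) \<and>
     (\<exists>K>0. \<exists>l>0. \<forall>\<xi>0 \<xi>. plant_solution f u \<xi>0 \<xi> \<longrightarrow>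
        (\<forall>t\<ge>0. norm (\<xi> t - xe) \<le> K * exp (- l * t) * norm (\<xi>0 - xe)))"

definition steady_state_map ::
  "((real^'n) \<times> (real^'m) \<Rightarrow> real^'n) \<Rightarrow> (real^'m \<Rightarrow> real^'n) \<Rightarrow> bool" where
  "steady_state_map f w \<longleftrightarrow>
     (\<forall>u. (\<exists>!xe. glob_exp_stable_equilibrium f u xe) \<and> glob_exp_stable_equilibrium f u (w u))"

section \<open>Constraint functions and regularity\<close>

primrec hseq ::
  "real \<Rightarrow> ((real^'n) \<times> (real^'m) \<Rightarrow> real^'n) \<Rightarrow> (real^'n \<Rightarrow> real) \<Rightarrow> nat
     \<Rightarrow> (real^'n) \<times> (real^'m) \<Rightarrow> real" where
  "hseq \<beta> f h 0 = (\<lambda>(x, u). h x)"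
| "hseq \<beta> f h (Suc i) =
     (\<lambda>(x, u). grad_x (hseq \<beta> f h i) x u \<bullet> f (x, u) + \<beta> * hseq \<beta> f h i (x, u))"

definition safe_set ::
  "(real^'n \<Rightarrow> real) \<Rightarrow> (real^'m \<Rightarrow> real) \<Rightarrow> ((real^'n) \<times> (real^'m)) set" where
  "safe_set h b = {(x, u). h x \<ge> 0 \<and> b u \<ge> 0}"

definition safe_set_i ::
  "real \<Rightarrow> ((real^'n) \<times> (real^'m) \<Rightarrow> real^'n) \<Rightarrow> (real^'n \<Rightarrow> real) \<Rightarrow> (real^'m \<Rightarrow> real) \<Rightarrow> nat
     \<Rightarrow> ((real^'n) \<times> (real^'m)) set" where
  "safe_set_i \<beta> f h b i = {(x, u). b u \<ge> 0 \<and> hseq \<beta> f h i (x, u) \<ge> 0}"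

definition regularity ::
  "real \<Rightarrow> ((real^'n) \<times> (real^'m) \<Rightarrow> real^'n) \<Rightarrow> (real^'n \<Rightarrow> real) \<Rightarrow> (real^'m \<Rightarrow> real)
     \<Rightarrow> (real^'n \<Rightarrow> real) \<Rightarrow> (real^'m \<Rightarrow> real^'n) \<Rightarrow> bool" where
  "regularity \<beta> f h b \<Phi> w \<longleftrightarrow>
     (\<exists>r\<ge>1. Ck (r + 1) f \<and> Ck (r + 2) h \<and>
        safe_set_i \<beta> f h b r \<noteq> {} \<and>
        (\<forall>(x, u) \<in> safe_set_i \<beta> f h b r. hseq \<beta> f h r (x, u) = 0 \<longrightarrow> grad_u (hseq \<beta> f h r) x u \<noteq> 0) \<and>
        (\<forall>(x, u) \<in> safe_set_i \<beta> f h b r. \<forall>i<r. grad_u (hseq \<beta> f h i) x u = 0)) \<and>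
     Ck 2 b \<and> (\<forall>(x, u) \<in> safe_set h b. b u = 0 \<longrightarrow> gradient b u \<noteq> 0) \<and>
     Ck 2 \<Phi> \<and> Ck 2 w"

section \<open>The optimization problems\<close>

definition feasible ::
  "(real^'m \<Rightarrow> real^'n) \<Rightarrow> (real^'n \<Rightarrow> real) \<Rightarrow> (real^'m \<Rightarrow> real) \<Rightarrow> (real^'n) \<times> (real^'m) \<Rightarrow> bool" where
  "feasible w h b = (\<lambda>(x, u). x = w u \<and> h x \<ge> 0 \<and> b u \<ge> 0)"

definition global_optimum ::
  "(real^'m \<Rightarrow> real^'n) \<Rightarrow> (real^'n \<Rightarrow> real) \<Rightarrow> (real^'m \<Rightarrow> real) \<Rightarrow> (real^'n \<Rightarrow> real)
     \<Rightarrow> real^'n \<Rightarrow> real^'m \<Rightarrow> bool" where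
  "global_optimum w h b \<Phi> x u \<longleftrightarrow> is_arg_min (\<lambda>(x, u). \<Phi> x) (feasible w h b) (x, u)"

definition penalized_optimum ::
  "(real^'m \<Rightarrow> real^'n) \<Rightarrow> (real^'n \<Rightarrow> real) \<Rightarrow> (real^'m \<Rightarrow> real) \<Rightarrow> (real^'n \<Rightarrow> real)
     \<Rightarrow> real \<Rightarrow> real \<Rightarrow> real^'n \<Rightarrow> real^'m \<Rightarrow> bool" where
  "penalized_optimum w h b \<Phi> p \<eta> x u \<longleftrightarrow>
     is_arg_min (\<lambda>(x, u). \<Phi> x + p * (\<eta> - h x)\<^sup>2) (feasible w h b) (x, u)"

definition MFCQ ::
  "(real^'m \<Rightarrow> real^'n) \<Rightarrow> (real^'n \<Rightarrow> real) \<Rightarrow> (real^'m \<Rightarrow> real) \<Rightarrow> real^'n \<Rightarrow> real^'m \<Rightarrow> bool" where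
  "MFCQ w h b x u \<longleftrightarrow>
     (\<exists>\<psi>x \<psi>u. \<psi>x = jacobian w (at u) *v \<psi>u \<and>
        (h x = 0 \<longrightarrow> gradient h x \<bullet> \<psi>x > 0) \<and>
        (b u = 0 \<longrightarrow> gradient b u \<bullet> \<psi>u > 0))"

end

theory Submission
  imports Defs
begin

text \<open>
  The problems (P) and its penalized version have the same feasible points, so everything follows
  from comparing a penalized optimizer with one well-chosen feasible point. Call \<open>\<Phi> xs\<close> the optimal
  value of (P).

  MFCQ supplies a direction \<open>\<psi>u\<close> of inputs along which \<open>b\<close> and \<open>h \<circ> w\<close> increase to first order
  whenever they vanish at \<open>us\<close>. A short step from \<open>us\<close> in this direction reaches an input \<open>u0\<close> with
  \<open>b u0 \<ge> 0\<close> and \<open>h (w u0) > 0\<close>, and by continuity \<open>\<Phi> (w u0) < \<Phi> xs + c\<close>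
  (lemma \<open>mfcq_strictly_feasible_point\<close>).

  Put \<open>\<eta> = h (w u0)\<close>, so that the penalty vanishes at \<open>u0\<close>, and then \<open>p = c / \<eta>\<^sup>2\<close>. For a penalized
  optimizer \<open>x'\<close> this gives \<open>\<Phi> x' + p * (\<eta> - h x')\<^sup>2 \<le> \<Phi> (w u0) < \<Phi> xs + c\<close>, while \<open>\<Phi> xs \<le> \<Phi> x'\<close>
  by optimality for (P). Hence \<open>\<Phi> x'\<close> is within \<open>c\<close> of \<open>\<Phi> xs\<close> and the penalty at \<open>x'\<close> is below
  \<open>c\<close>; but on the boundary \<open>h x' = 0\<close> the penalty would be exactly \<open>p * \<eta>\<^sup>2 = c\<close>.
\<close>

lemma Ck_imp_differentiable:
  assumes "Ck k g" "k > 0"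
  shows "g differentiable (at x)"
  using assms by (cases k) auto

lemma has_derivative_pos_eventually_increases:
  fixes g :: "'a::real_normed_vector \<Rightarrow> real"
  assumes "(g has_derivative D) (at x)" "D v > 0"
  shows "\<forall>\<^sub>F t in at_right 0. g x < g (x + t *\<^sub>R v)"
proof -
  have "((\<lambda>t. g (x + t *\<^sub>R v)) has_derivative (\<lambda>t. D (t *\<^sub>R v))) (at (0::real))"
    by (rule has_derivative_compose[of "\<lambda>t. x + t *\<^sub>R v"])
       (use assms(1) in \<open>auto intro!: derivative_eq_intros\<close>)
  moreover have "D (t *\<^sub>R v) = D v * t" for t
    using linear_scale[OF has_derivative_linear[OF assms(1)]] by (simp add: mult.commute)
  ultimately have "DERIV (\<lambda>t. g (x + t *\<^sub>R v)) 0 :> D v"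
    by (simp add: has_field_derivative_def)
  from DERIV_pos_inc_right[OF this assms(2)] show ?thesis
    unfolding eventually_at_right_field by force
qed

text \<open>A constraint is either active, and then increases because its derivative is positive, or
  inactive, and then stays positive by continuity.\<close>

lemma eventually_pos_along_direction:
  fixes g :: "'a::real_normed_vector \<Rightarrow> real"
  assumes "(g has_derivative D) (at x)" "g x \<ge> 0" "g x = 0 \<Longrightarrow> D v > 0"
  shows "\<forall>\<^sub>F t in at_right 0. g (x + t *\<^sub>R v) > 0"
proof (cases "g x = 0")
  case True
  with has_derivative_pos_eventually_increases[OF assms(1) assms(3)] show ?thesis
    by simp
next
  case False
  have "((\<lambda>t. x + t *\<^sub>R v) \<longlongrightarrow> x) (at_right 0)"
    by (auto intro!: tendsto_eq_intros)
  from isCont_tendsto_compose[OF has_derivative_continuous[OF assms(1)] this]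
  show ?thesis
    by (rule order_tendstoD) (use False assms(2) in simp)
qed

text \<open>A short step along the MFCQ direction enters the strict interior of the constraints, while the
  cost changes by an arbitrarily small amount because \<open>\<Phi> \<circ> w\<close> is continuous at \<open>u\<close>.\<close>

lemma mfcq_strictly_feasible_point:
  fixes h \<Phi> :: "real^'n \<Rightarrow> real" and b :: "real^'m \<Rightarrow> real" and w :: "real^'m \<Rightarrow> real^'n"
  assumes "w differentiable (at u)" "h differentiable (at (w u))" "b differentiable (at u)"
    and "isCont \<Phi> (w u)"
    and "h (w u) \<ge> 0" "b u \<ge> 0" "MFCQ w h b (w u) u" "c > 0"
  obtains u0 where "b u0 \<ge> 0" "h (w u0) > 0" "\<Phi> (w u0) < \<Phi> (w u) + c"
proof -
  from assms(7) obtain \<psi>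
    where \<psi>: "h (w u) = 0 \<Longrightarrow> gradient h (w u) \<bullet> (jacobian w (at u) *v \<psi>) > 0"
      "b u = 0 \<Longrightarrow> gradient b u \<bullet> \<psi> > 0"
    unfolding MFCQ_def by blast
  have w: "(w has_derivative (*v) (jacobian w (at u))) (at u)"
    using assms(1) jacobian_works by blast
  have hw: "((\<lambda>u. h (w u)) has_derivative
      (\<lambda>v. (jacobian w (at u) *v v) \<bullet> gradient h (w u))) (at u)"
    using gderiv_gradient[OF assms(2)] has_derivative_compose[OF w]
    unfolding gderiv_def by blast
  have b: "(b has_derivative (\<lambda>v. v \<bullet> gradient b u)) (at u)"
    using gderiv_gradient[OF assms(3)] unfolding gderiv_def .
  have "isCont (\<lambda>u. \<Phi> (w u)) u"
    using isCont_o2[OF has_derivative_continuous[OF w] assms(4)] .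
  moreover have "((\<lambda>t. u + t *\<^sub>R \<psi>) \<longlongrightarrow> u) (at_right 0)"
    by (auto intro!: tendsto_eq_intros)
  ultimately have "((\<lambda>t. \<Phi> (w (u + t *\<^sub>R \<psi>))) \<longlongrightarrow> \<Phi> (w u)) (at_right 0)"
    by (rule isCont_tendsto_compose)
  then have "\<forall>\<^sub>F t in at_right 0. \<Phi> (w (u + t *\<^sub>R \<psi>)) < \<Phi> (w u) + c"
    by (rule order_tendstoD) (use assms(8) in simp)
  moreover have "\<forall>\<^sub>F t in at_right 0. h (w (u + t *\<^sub>R \<psi>)) > 0"
    using hw assms(5) by (rule eventually_pos_along_direction) (use \<psi>(1) in \<open>simp add: inner_commute\<close>)
  moreover have "\<forall>\<^sub>F t in at_right 0. b (u + t *\<^sub>R \<psi>) > 0"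
    using b assms(6) by (rule eventually_pos_along_direction) (use \<psi>(2) in \<open>simp add: inner_commute\<close>)
  ultimately have "\<forall>\<^sub>F t in at_right (0::real). b (u + t *\<^sub>R \<psi>) > 0 \<and> h (w (u + t *\<^sub>R \<psi>)) > 0 \<and>
      \<Phi> (w (u + t *\<^sub>R \<psi>)) < \<Phi> (w u) + c"
    by eventually_elim simp
  from eventually_happens'[OF trivial_limit_at_right_real this] that show ?thesis
    by (auto intro: less_imp_le)
qed

theorem propositionV2:
  fixes f :: "(real^'n) \<times> (real^'m) \<Rightarrow> real^'n"
    and h \<Phi> :: "real^'n \<Rightarrow> real"
    and b :: "real^'m \<Rightarrow> real"
    and w :: "real^'m \<Rightarrow> real^'n"
    and \<beta> c :: real
    and xs :: "real^'n" and us :: "real^'m"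
  assumes "\<beta> > 0"
    and "steady_state_map f w"
    and "regularity \<beta> f h b \<Phi> w"
    and "global_optimum w h b \<Phi> xs us"
    and "h xs = 0"
    and "MFCQ w h b xs us"
    and "c > 0"
  shows "\<exists>p>0. \<exists>\<eta>>0. \<forall>xs' us'. penalized_optimum w h b \<Phi> p \<eta> xs' us' \<longrightarrow>
           h xs' > 0 \<and> \<bar>\<Phi> xs' - \<Phi> xs\<bar> < c"
proof -
  obtain r where "Ck (r + 2) h" "Ck 2 b" "Ck 2 \<Phi>" "Ck 2 w"
    using assms(3) unfolding regularity_def by blast
  then have diff: "h differentiable (at x)" "\<Phi> differentiable (at x)"
      "b differentiable (at u)" "w differentiable (at u)" for x u
    by (auto intro: Ck_imp_differentiable)
  have xs: "xs = w us" and "b us \<ge> 0"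
    and opt: "\<And>x u. feasible w h b (x, u) \<Longrightarrow> \<Phi> xs \<le> \<Phi> x"
    using assms(4) by (auto simp: global_optimum_def is_arg_min_linorder feasible_def)
  obtain u0 where u0: "b u0 \<ge> 0" "h (w u0) > 0" "\<Phi> (w u0) < \<Phi> xs + c"
    using mfcq_strictly_feasible_point[of w us h b \<Phi> c] diff \<open>b us \<ge> 0\<close> assms(5-7)
      differentiable_imp_continuous_within[OF diff(2)]
    unfolding xs by auto
  define \<eta> where "\<eta> = h (w u0)"
  define p where "p = c / \<eta>\<^sup>2"
  have pos: "\<eta> > 0" "p > 0"
    using u0(2) assms(7) by (auto simp: \<eta>_def p_def)
  have "h x > 0 \<and> \<bar>\<Phi> x - \<Phi> xs\<bar> < c" if "penalized_optimum w h b \<Phi> p \<eta> x u" for x u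
  proof -
    have feas: "feasible w h b (x, u)"
      and min: "\<And>x' u'. feasible w h b (x', u') \<Longrightarrow>
        \<Phi> x + p * (\<eta> - h x)\<^sup>2 \<le> \<Phi> x' + p * (\<eta> - h x')\<^sup>2"
      using that by (auto simp: penalized_optimum_def is_arg_min_linorder)
    have "feasible w h b (w u0, u0)"
      using u0 by (simp add: feasible_def)
    from min[OF this] have le: "\<Phi> x + p * (\<eta> - h x)\<^sup>2 < \<Phi> xs + c"
      using u0(3) by (simp add: \<eta>_def)
    have ge: "\<Phi> xs \<le> \<Phi> x"
      using opt[OF feas] .
    have "h x \<noteq> 0"
    proof
      assume "h x = 0"
      then have "p * (\<eta> - h x)\<^sup>2 = c"
        using pos(1) by (simp add: p_def)
      with le ge show False
        by simp
    qed
    moreover have "h x \<ge> 0"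
      using feas by (auto simp: feasible_def)
    moreover have "p * (\<eta> - h x)\<^sup>2 \<ge> 0"
      using pos by simp
    ultimately show ?thesis
      using le ge by simp
  qed
  with pos show ?thesis
    by blast
qed

end
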